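(* Let $q\ge1$ be an integer and let $f$ be Riemann integrable on $[0,1]$ with $f(0)=f(1)$, such that $f$ is continuous at the points $\ell/q$ for $\ell=1,2,\dots,q$. Let $a$ be an integer with $1\le a\le q$. Then $$f\!\left(\frac{a}{q}\right)=\sum_{r=1}^{q}b_r\,e^{\frac{2\pi i r a}{q}},$$ where $b_r=\int_0^1\psi(u,q-r,q)\,df(u)$ for $r=1,2,\dots,q-1$ and $b_q=\int_0^1 f(u)\,du+\int_0^1\psi(u,q,q)\,df(u)$ (Riemann–Stieltjes integrals). In particular the coefficients $b_r$ do not depend on $a\in\{1,\dots,q\}$.
   Context: For integers $q\ge1$ and $1\le r\le q$ and real $u$, define $$\psi(u,r,q)=-\sum_{\substack{|n|\ge1\\ n\equiv r \ (\mathrm{mod}\ q)}}\frac{e^{2\pi i n u}}{2\pi i n},$$ the sum being over nonzero integers $n\equiv r\pmod q$, understood as the limit as $M\to\infty$ of the partial sums over $n=mq+r$ with $-M\le m\le M$ (omitting $n=0$).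
   Formalization: Continuity at ℓ/q is required of the 1-periodic extension of f, so at ℓ=q f must also be right-continuous at 0; otherwise the Stieltjes integrals do not exist (e.g. q=1, f(0)=0, f(u)=1−u on (0,1]). *)

theory Defs
  imports "HOL-Analysis.Analysis"
begin

text \<open>
  Riemann--Stieltjes integral of \<open>\<phi>\<close> against \<open>g\<close> over \<open>[a,b]\<close>, as the limit of the tagged
  sums \<open>\<Sum> \<phi>(\<xi>\<^sub>i) (g(x\<^sub>i) - g(x\<^sub>i\<^sub>-\<^sub>1))\<close> when the mesh tends to 0. The constant gauge
  \<open>\<lambda>x. ball x d\<close> (instead of the arbitrary gauges of the Henstock--Kurzweil integral) is what
  makes this a mesh condition. No bounded variation of \<open>g\<close> is required.
\<close>

definition has_RS_integral ::
    "(real \<Rightarrow> complex) \<Rightarrow> (real \<Rightarrow> complex) \<Rightarrow> real \<Rightarrow> real \<Rightarrow> complex \<Rightarrow> bool" where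
  "has_RS_integral \<phi> g a b I \<longleftrightarrow>
     (\<forall>e>0. \<exists>d>0. \<forall>p. p tagged_division_of {a..b} \<and> (\<lambda>x. ball x d) fine p \<longrightarrow>
        norm ((\<Sum>(x, K)\<in>p. \<phi> x * (g (Sup K) - g (Inf K))) - I) < e)"

definition RS_integrable :: "(real \<Rightarrow> complex) \<Rightarrow> (real \<Rightarrow> complex) \<Rightarrow> real \<Rightarrow> real \<Rightarrow> bool" where
  "RS_integrable \<phi> g a b \<longleftrightarrow> (\<exists>I. has_RS_integral \<phi> g a b I)"

definition RS_integral :: "(real \<Rightarrow> complex) \<Rightarrow> (real \<Rightarrow> complex) \<Rightarrow> real \<Rightarrow> real \<Rightarrow> complex" where
  "RS_integral \<phi> g a b = (THE I. has_RS_integral \<phi> g a b I)"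

lemma has_RS_integral_unique:
  assumes "has_RS_integral \<phi> g a b I" "has_RS_integral \<phi> g a b J"
  shows "I = J"
proof (rule ccontr)
  assume "I \<noteq> J"
  then have e: "norm (I - J) / 2 > 0" by simp
  let ?S = "\<lambda>p. \<Sum>(x, K)\<in>p. \<phi> x * (g (Sup K) - g (Inf K))"
  obtain d1 where d1: "d1 > 0" "\<And>p. p tagged_division_of {a..b} \<Longrightarrow> (\<lambda>x. ball x d1) fine p \<Longrightarrow>
      norm (?S p - I) < norm (I - J) / 2"
    using assms(1) e unfolding has_RS_integral_def by meson
  obtain d2 where d2: "d2 > 0" "\<And>p. p tagged_division_of {a..b} \<Longrightarrow> (\<lambda>x. ball x d2) fine p \<Longrightarrow>
      norm (?S p - J) < norm (I - J) / 2"
    using assms(2) e unfolding has_RS_integral_def by meson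
  have "gauge (\<lambda>x::real. ball x (min d1 d2))"
    using d1(1) d2(1) by (simp add: gauge_def)
  then obtain p where p: "p tagged_division_of cbox a b" "(\<lambda>x. ball x (min d1 d2)) fine p"
    using fine_division_exists by blast
  have "(\<lambda>x. ball x d1) fine p" "(\<lambda>x. ball x d2) fine p"
    using p(2) by (fastforce simp: fine_def)+
  then have "norm (?S p - I) < norm (I - J) / 2" "norm (?S p - J) < norm (I - J) / 2"
    using d1(2) d2(2) p(1) by auto
  then show False
    using norm_triangle_ineq4[of "?S p - J" "?S p - I"] by simp
qed

lemma RS_integral_eqI: "has_RS_integral \<phi> g a b I \<Longrightarrow> RS_integral \<phi> g a b = I"
  unfolding RS_integral_def using has_RS_integral_unique by blast

lemma RS_integrable_has_integral:
  "RS_integrable \<phi> g a b \<Longrightarrow> has_RS_integral \<phi> g a b (RS_integral \<phi> g a b)"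
  unfolding RS_integrable_def using RS_integral_eqI by blast

abbreviation Riemann_integrable :: "(real \<Rightarrow> complex) \<Rightarrow> real \<Rightarrow> real \<Rightarrow> bool" where
  "Riemann_integrable f a b \<equiv> RS_integrable f of_real a b"

text \<open>
  The Riemann integral agrees with the library's gauge integral, so the latter denotes its value.
\<close>

lemma has_RS_integral_of_real_imp_has_integral:
  assumes "has_RS_integral f of_real a b I"
  shows "(f has_integral I) {a..b}"
proof -
  have "\<exists>\<gamma>. gauge \<gamma> \<and> (\<forall>p. p tagged_division_of cbox a b \<and> \<gamma> fine p \<longrightarrow>
          norm ((\<Sum>(x,k)\<in>p. measure lborel k *\<^sub>R f x) - I) < e)" if e: "e > 0" for e
  proof -
    obtain d where d: "d > 0" "\<And>p. p tagged_division_of {a..b} \<Longrightarrow> (\<lambda>x. ball x d) fine p \<Longrightarrow>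
        norm ((\<Sum>(x, K)\<in>p. f x * (of_real (Sup K) - of_real (Inf K))) - I) < e"
      using assms e unfolding has_RS_integral_def by meson
    have eq: "(\<Sum>(x,k)\<in>p. measure lborel k *\<^sub>R f x) =
          (\<Sum>(x, K)\<in>p. f x * (of_real (Sup K) - of_real (Inf K)))"
      if p: "p tagged_division_of cbox a b" for p
    proof (rule sum.cong[OF refl], clarify)
      fix x k assume xk: "(x, k) \<in> p"
      obtain u v where k: "k = cbox u v" using tagged_division_ofD(4)[OF p xk] by blast
      moreover have "x \<in> k" using tagged_division_ofD(2)[OF p xk] .
      ultimately have "u \<le> v" by auto
      then show "measure lborel k *\<^sub>R f x = f x * (of_real (Sup k) - of_real (Inf k))"
        using k by (simp add: scaleR_conv_of_real mult.commute)
    qed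
    have "gauge (\<lambda>x::real. ball x d)" using d(1) by (simp add: gauge_def)
    then show ?thesis using d(2) eq by (intro exI[of _ "\<lambda>x. ball x d"]) auto
  qed
  then have "(f has_integral I) (cbox a b)" unfolding has_integral by blast
  then show ?thesis by simp
qed

text \<open>
  \<open>psi\<close> is a limit of partial sums symmetric in \<open>m\<close>, where \<open>n = m q + r\<close>; the series
  does not converge absolutely.
\<close>

definition psi :: "real \<Rightarrow> nat \<Rightarrow> nat \<Rightarrow> complex" where
  "psi u r q = - lim (\<lambda>M::nat.
     \<Sum>n \<in> {n. \<exists>m\<in>{- int M..int M}. n = m * int q + int r} - {0}.
       exp (2 * pi * \<i> * of_int n * u) / (2 * pi * \<i> * of_int n))"

definition fcoeff :: "(real \<Rightarrow> complex) \<Rightarrow> nat \<Rightarrow> nat \<Rightarrow> complex" where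
  "fcoeff f q r =
     (if r = q then integral {0..1} f + RS_integral (\<lambda>u. psi u q q) f 0 1
      else RS_integral (\<lambda>u. psi u (q - r) q) f 0 1)"

text \<open>
  For \<open>f 0 = f 1\<close> this is the 1-periodic extension of \<open>f\<close> on \<open>[0,1]\<close>. Its continuity at 1
  means that \<open>f\<close> is left-continuous at 1 and right-continuous at 0.
\<close>

definition periodize :: "(real \<Rightarrow> complex) \<Rightarrow> real \<Rightarrow> complex" where
  "periodize f x = f (frac x)"

end

theory Submission
  imports Defs "HOL-Real_Asymp.Real_Asymp"
begin

text \<open>
  Detecting the congruence by characters, \<open>\<psi>(u, r, q)\<close> is the average over \<open>l = 1, \<dots>, q\<close> of the
  translates \<open>e(l r / q) s(u - l / q)\<close> of the sawtooth \<open>s\<close>, whose Fourier series is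
  \<open>- \<Sum> e(n x) / (2 \<pi> i n)\<close>. The function \<open>s(u - l / q)\<close> is linear plus a unit jump at
  \<open>l / q\<close>, where \<open>f\<close> is continuous, so its integral against \<open>df\<close> exists and equals
  \<open>f(l / q) - \<integral> f\<close> by parts. Hence \<open>b\<^sub>r\<close> is the discrete Fourier coefficient
  \<open>(1 / q) \<Sum>\<^sub>l e(- l r / q) f(l / q)\<close>, and finite Fourier inversion gives the claim.
\<close>

section \<open>Riemann--Stieltjes integrals\<close>

definition RS_sum :: "(real \<Rightarrow> complex) \<Rightarrow> (real \<Rightarrow> complex) \<Rightarrow> (real \<times> real set) set \<Rightarrow> complex" where
  "RS_sum \<phi> g p = (\<Sum>(x, K)\<in>p. \<phi> x * (g (Sup K) - g (Inf K)))"

text \<open>Packaging "mesh tends to 0" as a filter turns \<open>has_RS_integral\<close> into an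
  ordinary limit, so linearity in the integrand follows from the limit laws.\<close>

definition mesh_filter :: "real \<Rightarrow> real \<Rightarrow> (real \<times> real set) set filter" where
  "mesh_filter a b =
     (INF d\<in>{0<..}. principal {p. p tagged_division_of {a..b} \<and> (\<lambda>x. ball x d) fine p})"

lemma eventually_mesh_filter:
  "eventually P (mesh_filter a b) \<longleftrightarrow>
     (\<exists>d>0. \<forall>p. p tagged_division_of {a..b} \<and> (\<lambda>x. ball x d) fine p \<longrightarrow> P p)"
proof -
  have "eventually P (mesh_filter a b) \<longleftrightarrow>
      (\<exists>d\<in>{0<..}. eventually P
         (principal {p. p tagged_division_of {a..b} \<and> (\<lambda>x. ball x d) fine p}))"
    unfolding mesh_filter_def
  proof (rule eventually_INF_base)
    fix c d :: real assume "c \<in> {0<..}" "d \<in> {0<..}"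
    moreover have "(\<lambda>x. ball x c) fine p \<and> (\<lambda>x. ball x d) fine p"
      if "(\<lambda>x. ball x (min c d)) fine p" for p :: "(real \<times> real set) set"
      using that by (fastforce simp: fine_def)
    ultimately show "\<exists>x\<in>{0<..}. principal {p. p tagged_division_of {a..b} \<and> (\<lambda>u. ball u x) fine p}
        \<le> inf (principal {p. p tagged_division_of {a..b} \<and> (\<lambda>x. ball x c) fine p})
              (principal {p. p tagged_division_of {a..b} \<and> (\<lambda>x. ball x d) fine p})"
      by (intro bexI[of _ "min c d"]) auto
  qed auto
  then show ?thesis
    by (auto simp: eventually_principal)
qed

lemma has_RS_integral_iff_tendsto:
  "has_RS_integral \<phi> g a b I \<longleftrightarrow> (RS_sum \<phi> g \<longlongrightarrow> I) (mesh_filter a b)"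
  unfolding tendsto_iff eventually_mesh_filter has_RS_integral_def RS_sum_def dist_norm ..

lemma has_RS_integral_sum:
  assumes "\<And>i. i \<in> A \<Longrightarrow> has_RS_integral (\<phi> i) g a b (I i)"
  shows "has_RS_integral (\<lambda>u. \<Sum>i\<in>A. \<phi> i u) g a b (\<Sum>i\<in>A. I i)"
proof -
  have "RS_sum (\<lambda>u. \<Sum>i\<in>A. \<phi> i u) g = (\<lambda>p. \<Sum>i\<in>A. RS_sum (\<phi> i) g p)"
    unfolding RS_sum_def
    by (rule ext, subst sum.swap) (simp add: sum_distrib_right case_prod_unfold)
  then show ?thesis
    using assms by (auto simp: has_RS_integral_iff_tendsto intro!: tendsto_sum)
qed

lemma has_RS_integral_cmult:
  assumes "has_RS_integral \<phi> g a b I"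
  shows "has_RS_integral (\<lambda>u. k * \<phi> u) g a b (k * I)"
proof -
  have "RS_sum (\<lambda>u. k * \<phi> u) g = (\<lambda>p. k * RS_sum \<phi> g p)"
    unfolding RS_sum_def by (simp add: sum_distrib_left case_prod_unfold mult.assoc)
  then show ?thesis
    using assms by (auto simp: has_RS_integral_iff_tendsto intro!: tendsto_mult_left)
qed

lemma has_RS_integral_add:
  assumes "has_RS_integral \<phi> g a b I" "has_RS_integral \<psi> g a b J"
  shows "has_RS_integral (\<lambda>u. \<phi> u + \<psi> u) g a b (I + J)"
proof -
  have "RS_sum (\<lambda>u. \<phi> u + \<psi> u) g = (\<lambda>p. RS_sum \<phi> g p + RS_sum \<psi> g p)"
    unfolding RS_sum_def by (rule ext) (simp add: sum.distrib case_prod_unfold distrib_right)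
  then show ?thesis
    using assms by (auto simp: has_RS_integral_iff_tendsto intro!: tendsto_add)
qed

section \<open>Tagged divisions, and the integrals of constants, steps and the identity\<close>

lemma tagged_division_of_realD:
  fixes a b :: real
  assumes "p tagged_division_of {a..b}" "(x, K) \<in> p"
  shows "Inf K \<le> x" "x \<le> Sup K" "a \<le> Inf K" "Sup K \<le> b"
    and "Inf K \<in> K" "Sup K \<in> K" "interior K = {Inf K<..<Sup K}"
    and tagged_division_of_real_eq: "K = {Inf K..Sup K}"
proof -
  obtain u v where K: "K = {u..v}"
    using tagged_division_ofD(4)[OF assms] by auto
  moreover have x: "x \<in> K" and "K \<subseteq> {a..b}"
    using tagged_division_ofD(2,3)[OF assms] .
  ultimately show "Inf K \<le> x" "x \<le> Sup K" "a \<le> Inf K" "Sup K \<le> b"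
    "Inf K \<in> K" "Sup K \<in> K" "interior K = {Inf K<..<Sup K}" "K = {Inf K..Sup K}"
    by auto
qed

text \<open>Tags and endpoints of pieces all lie in \<open>{a..b}\<close>, so the sums never see
  values outside. This lets \<open>f\<close> be exchanged with its periodic extension.\<close>

lemma has_RS_integral_cong:
  assumes "has_RS_integral \<phi> g a b I"
    and \<phi>: "\<And>u. u \<in> {a..b} \<Longrightarrow> \<phi> u = \<phi>' u" and g: "\<And>u. u \<in> {a..b} \<Longrightarrow> g u = g' u"
  shows "has_RS_integral \<phi>' g' a b I"
proof -
  have "(\<Sum>(x, K)\<in>p. \<phi> x * (g (Sup K) - g (Inf K))) = (\<Sum>(x, K)\<in>p. \<phi>' x * (g' (Sup K) - g' (Inf K)))"
    if p: "p tagged_division_of {a..b}" for p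
  proof (rule sum.cong[OF refl], clarify)
    fix x K assume xK: "(x, K) \<in> p"
    show "\<phi> x * (g (Sup K) - g (Inf K)) = \<phi>' x * (g' (Sup K) - g' (Inf K))"
      using tagged_division_of_realD(1-4)[OF p xK] by (simp add: \<phi> g)
  qed
  then show ?thesis
    using assms(1) unfolding has_RS_integral_def by (simp cong: conj_cong imp_cong)
qed

lemma sum_increments_tagged_division:
  fixes h :: "real \<Rightarrow> complex"
  assumes "a \<le> b" "p tagged_division_of {a..b}"
  shows "(\<Sum>(x, K)\<in>p. h (Sup K) - h (Inf K)) = h b - h a"
  using additive_tagged_division_1[OF assms] by simp

lemma has_RS_integral_const:
  assumes "a \<le> b"
  shows "has_RS_integral (\<lambda>u. k) g a b (k * (g b - g a))"
proof -
  have "(\<Sum>(x, K)\<in>p. k * (g (Sup K) - g (Inf K))) = k * (g b - g a)"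
    if "p tagged_division_of {a..b}" for p
    using sum_increments_tagged_division[OF assms that, of g]
    by (simp add: sum_distrib_left[symmetric] case_prod_unfold)
  then show ?thesis
    unfolding has_RS_integral_def by (auto intro!: exI[of _ 1])
qed

text \<open>Distinct members of a division have disjoint interiors. This bounds the pieces
  straddling a jump by one, and rules out collisions of nondegenerate halves in
  \<open>tagged_division_swap\<close>.\<close>

lemma tagged_division_overlap_unique:
  fixes a b :: real
  assumes p: "p tagged_division_of {a..b}" and "(x, K) \<in> p" "(x', K') \<in> p"
    and "max (Inf K) (Inf K') < min (Sup K) (Sup K')"
  shows "(x, K) = (x', K')"
proof (rule ccontr)
  assume "(x, K) \<noteq> (x', K')"
  then have "interior K \<inter> interior K' = {}"
    using tagged_division_ofD(5)[OF p] assms by blast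
  moreover have "interior K = {Inf K<..<Sup K}" "interior K' = {Inf K'<..<Sup K'}"
    using tagged_division_of_realD(7)[OF p] assms by blast+
  moreover obtain z where "max (Inf K) (Inf K') < z" "z < min (Sup K) (Sup K')"
    using dense[OF assms(4)] by blast
  ultimately show False
    by auto
qed

text \<open>
  Replacing the step by the increments of \<open>g (min u c)\<close> changes only the term of
  the one interval that straddles \<open>c\<close>, and that term is small by continuity of \<open>g\<close>.
\<close>

lemma has_RS_integral_step:
  fixes g :: "real \<Rightarrow> complex"
  assumes c: "a \<le> c" "c \<le> b" and g: "isCont g c"
    and P: "\<And>u. u < c \<Longrightarrow> P u" "\<And>u. u > c \<Longrightarrow> \<not> P u"
  shows "has_RS_integral (\<lambda>u. if P u then 1 else 0) g a b (g c - g a)"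
  unfolding has_RS_integral_def
proof (intro allI impI)
  fix e :: real assume "e > 0"
  then obtain d where d: "d > 0" "\<And>u. \<bar>u - c\<bar> < d \<Longrightarrow> norm (g u - g c) < e / 2"
    using g unfolding continuous_at_eps_delta dist_norm real_norm_def
    by (meson half_gt_zero)
  \<comment> \<open>Fineness \<open>d / 2\<close> around the tag puts both ends of a piece within
    \<open>d\<close> of every point of the piece, in particular of \<open>c\<close> if it lies
    there.\<close>
  have "norm ((\<Sum>(x, K)\<in>p. (if P x then 1 else 0) * (g (Sup K) - g (Inf K))) - (g c - g a)) < e"
    if p: "p tagged_division_of {a..b}" "(\<lambda>x. ball x (d / 2)) fine p" for p
  proof -
    \<comment> \<open>The strict inequality is on the side where the step changes value, so
      degenerate pieces and pieces touching \<open>c\<close> only from the other side are not bad.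
      Two bad pieces would overlap next to \<open>c\<close>.\<close>
    define bad where "bad = (\<lambda>K. if P c then Inf K \<le> c \<and> c < Sup K else Inf K < c \<and> c \<le> Sup K)"
    define D where "D = (\<lambda>(x, K). (if P x then 1 else 0) * (g (Sup K) - g (Inf K))
        - (g (min (Sup K) c) - g (min (Inf K) c)))"
    define B where "B = {(x, K)\<in>p. bad K}"
    have fin: "finite p" using p(1) by auto
    have "finite B" unfolding B_def using fin by (auto intro: finite_subset)
    then have "card B \<le> Suc 0"
    proof (subst card_le_Suc0_iff_eq, assumption, intro ballI)
      fix y z assume "y \<in> B" "z \<in> B"
      moreover obtain x K x' K' where "y = (x, K)" "z = (x', K')" by fastforce
      ultimately show "y = z"
        using tagged_division_overlap_unique[OF p(1), of x K x' K']
        by (auto simp: B_def bad_def split: if_splits)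
    qed
    have D0: "D y = 0" if "y \<in> p - B" for y
    proof -
      obtain x K where y: "y = (x, K)" by fastforce
      then have xK: "(x, K) \<in> p" and "\<not> bad K" using that by (auto simp: B_def)
      then consider "Sup K < c \<or> Sup K \<le> c \<and> P c" | "Inf K > c \<or> Inf K \<ge> c \<and> \<not> P c"
        by (force simp: bad_def split: if_splits)
      then show ?thesis
      proof cases
        case 1
        then have "P x" using tagged_division_of_realD(1-4)[OF p(1) xK] P(1)[of x]
          by (cases "x = c") auto
        then show ?thesis using 1 tagged_division_of_realD[OF p(1) xK]
          by (auto simp: D_def y min_def)
      next
        case 2
        then have "\<not> P x" using tagged_division_of_realD(1-4)[OF p(1) xK] P(2)[of x]
          by (cases "x = c") auto
        moreover have "min (Inf K) c = c" "min (Sup K) c = c"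
          using 2 tagged_division_of_realD(1-4)[OF p(1) xK] by auto
        ultimately show ?thesis
          by (simp add: D_def y)
      qed
    qed
    have DB: "norm (D y) \<le> e / 2" if "y \<in> B" for y
    proof -
      obtain x K where y: "y = (x, K)" by fastforce
      then have xK: "(x, K) \<in> p" and K: "Inf K \<le> c" "c \<le> Sup K"
        using that by (auto simp: B_def bad_def split: if_splits)
      have "K \<subseteq> ball x (d / 2)" using p(2) xK by (auto simp: fine_def)
      then have "\<bar>x - Inf K\<bar> < d / 2" "\<bar>x - Sup K\<bar> < d / 2"
        using tagged_division_of_realD(5,6)[OF p(1) xK] by (auto simp: subset_iff dist_real_def)
      then have "\<bar>Inf K - c\<bar> < d" "\<bar>Sup K - c\<bar> < d"
        using K by linarith+
      \<comment> \<open>As \<open>c\<close> lies in \<open>K\<close>, the truncated increment is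
        \<open>g c - g (Inf K)\<close>; for either value of the step at the tag, a difference from
        \<open>g c\<close> remains.\<close>
      moreover have "D y = (if P x then g (Sup K) - g c else g (Inf K) - g c)"
        using K by (simp add: D_def y min_def)
      ultimately show ?thesis
        using d(2) by (simp add: less_imp_le)
    qed
    have "(\<Sum>y\<in>p. D y) = (\<Sum>(x, K)\<in>p. (if P x then 1 else 0) * (g (Sup K) - g (Inf K)))
        - (\<Sum>(x, K)\<in>p. g (min (Sup K) c) - g (min (Inf K) c))"
      unfolding D_def by (simp add: sum_subtractf case_prod_unfold)
    also have "(\<Sum>(x, K)\<in>p. g (min (Sup K) c) - g (min (Inf K) c)) = g c - g a"
      using sum_increments_tagged_division[OF _ p(1), of "\<lambda>u. g (min u c)"] c by (simp add: min_def)
    finally have "(\<Sum>(x, K)\<in>p. (if P x then 1 else 0) * (g (Sup K) - g (Inf K))) - (g c - g a)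
        = (\<Sum>y\<in>p. D y)" by simp
    also have "\<dots> = (\<Sum>y\<in>B. D y)"
      using D0 fin by (intro sum.mono_neutral_right) (auto simp: B_def)
    also have "norm \<dots> \<le> of_nat (card B) * (e / 2)"
      using DB by (rule sum_norm_bound)
    also have "\<dots> \<le> 1 * (e / 2)"
      using \<open>card B \<le> Suc 0\<close> \<open>e > 0\<close> by (intro mult_right_mono) auto
    also have "\<dots> < e" using \<open>e > 0\<close> by simp
    finally show ?thesis .
  qed
  then show "\<exists>d>0. \<forall>p. p tagged_division_of {a..b} \<and> (\<lambda>x. ball x d) fine p \<longrightarrow>
      norm ((\<Sum>(x, K)\<in>p. (if P x then 1 else 0) * (g (Sup K) - g (Inf K))) - (g c - g a)) < e"
    using d(1) by (intro exI[of _ "d / 2"]) auto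
qed

text \<open>
  Summation by parts: swapping the roles of tags and division points turns a
  Riemann--Stieltjes sum of the identity against \<open>g\<close> into a Riemann sum of \<open>g\<close>.
\<close>

lemma tagged_division_swap:
  fixes p :: "(real \<times> real set) set"
  assumes p: "p tagged_division_of {a..b}" "(\<lambda>x. ball x d) fine p"
  defines "p' \<equiv> (\<lambda>(x, K). (Sup K, {x..Sup K})) ` p \<union> (\<lambda>(x, K). (Inf K, {Inf K..x})) ` p"
  shows "p' tagged_division_of {a..b}" "(\<lambda>x. ball x d) fine p'"
    and "RS_sum g of_real p' =
      (\<Sum>(x, K)\<in>p. g (Sup K) * of_real (Sup K - x) + g (Inf K) * of_real (x - Inf K))"
proof -
  note tD = tagged_division_of_realD(1-4)[OF p(1)]
  note K_eq = tagged_division_of_real_eq[OF p(1)]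
  have fin: "finite p" using p(1) by auto
  have piece: "\<exists>x K. (x, K) \<in> p \<and> (t = Sup K \<and> L = {x..Sup K} \<or> t = Inf K \<and> L = {Inf K..x})"
    if "(t, L) \<in> p'" for t L
    using that by (auto simp: p'_def)
  have eq: "interior K \<inter> interior K' = {}" if "(x, K) \<in> p" "(x', K') \<in> p" "(x, K) \<noteq> (x', K')" for x K x' K'
    using tagged_division_ofD(5)[OF p(1)] that by blast
  show "p' tagged_division_of {a..b}"
  proof (rule tagged_division_ofI)
    show "finite p'" using fin by (simp add: p'_def)
  next
    fix t L assume "(t, L) \<in> p'"
    then obtain x K where xK: "(x, K) \<in> p" "t = Sup K \<and> L = {x..Sup K} \<or> t = Inf K \<and> L = {Inf K..x}"
      using piece by blast
    show "t \<in> L" "L \<subseteq> {a..b}" "\<exists>u v. L = cbox u v"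
      using xK tD[OF xK(1)] by auto
  next
    fix t L t' L' assume tL: "(t, L) \<in> p'" "(t', L') \<in> p'" "(t, L) \<noteq> (t', L')"
    obtain x K where xK: "(x, K) \<in> p" "t = Sup K \<and> L = {x..Sup K} \<or> t = Inf K \<and> L = {Inf K..x}"
      using piece tL(1) by blast
    obtain x' K' where xK': "(x', K') \<in> p" "t' = Sup K' \<and> L' = {x'..Sup K'} \<or> t' = Inf K' \<and> L' = {Inf K'..x'}"
      using piece tL(2) by blast
    \<comment> \<open>Two halves of one piece meet at most in the tag; halves of different pieces
      lie in pieces with disjoint interiors.\<close>
    show "interior L \<inter> interior L' = {}"
    proof (cases "(x, K) = (x', K')")
      case True
      then show ?thesis using xK xK' tL(3) by (auto simp: interior_atLeastAtMost_real)
    next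
      case False
      have "L \<subseteq> {Inf K..Sup K}" "L' \<subseteq> {Inf K'..Sup K'}"
        using xK xK' tD[OF xK(1)] tD[OF xK'(1)] by auto
      then have "L \<subseteq> K" "L' \<subseteq> K'"
        using K_eq[OF xK(1)] K_eq[OF xK'(1)] by blast+
      then show ?thesis
        using eq[OF xK(1) xK'(1) False] interior_mono by blast
    qed
  next
    have "\<Union>{L. \<exists>t. (t, L) \<in> p'} = \<Union>{K. \<exists>x. (x, K) \<in> p}"
    proof (intro equalityI subsetI)
      fix z assume "z \<in> \<Union>{L. \<exists>t. (t, L) \<in> p'}"
      then obtain t L where "(t, L) \<in> p'" "z \<in> L" by blast
      then obtain x K where xK: "(x, K) \<in> p" "z \<in> {x..Sup K} \<or> z \<in> {Inf K..x}"
        using piece by blast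
      then have "z \<in> {Inf K..Sup K}"
        using tD[OF xK(1)] by auto
      with xK(1) show "z \<in> \<Union>{K. \<exists>x. (x, K) \<in> p}"
        using K_eq by blast
    next
      fix z assume "z \<in> \<Union>{K. \<exists>x. (x, K) \<in> p}"
      then obtain x K where xK: "(x, K) \<in> p" "z \<in> K" by blast
      then have "z \<in> {Inf K..Sup K}" using K_eq by blast
      then have "z \<in> {x..Sup K} \<or> z \<in> {Inf K..x}" by auto
      moreover have "(Sup K, {x..Sup K}) \<in> p'" "(Inf K, {Inf K..x}) \<in> p'"
        using xK(1) by (force simp: p'_def)+
      ultimately show "z \<in> \<Union>{L. \<exists>t. (t, L) \<in> p'}" by blast
    qed
    then show "\<Union>{L. \<exists>t. (t, L) \<in> p'} = {a..b}"
      using tagged_division_ofD(6)[OF p(1)] by simp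
  qed
  show "(\<lambda>x. ball x d) fine p'"
    unfolding fine_def
  proof clarify
    fix t L z assume "(t, L) \<in> p'" "z \<in> L"
    then obtain x K where xK: "(x, K) \<in> p" "t = Sup K \<and> L = {x..Sup K} \<or> t = Inf K \<and> L = {Inf K..x}"
      using piece by blast
    have "K \<subseteq> ball x d" using p(2) xK by (auto simp: fine_def)
    moreover have "Inf K \<in> K" "Sup K \<in> K"
      using tagged_division_of_realD(5,6)[OF p(1) xK(1)] .
    ultimately have "dist x (Inf K) < d" "dist x (Sup K) < d" by auto
    then show "z \<in> ball t d"
      using xK(2) tD[OF xK(1)] \<open>z \<in> L\<close> by (auto simp: dist_real_def)
  qed
  let ?h = "\<lambda>(x, K). g x * (of_real (Sup K) - of_real (Inf K)) :: complex"
  let ?R = "\<lambda>(x, K). (Sup K, {x..Sup K})" and ?L = "\<lambda>(x, K). (Inf K, {Inf K..x})"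
  \<comment> \<open>\<open>p'\<close> is a set, so equal halves of different pieces are counted
    once. That is harmless: such halves are single points with increment 0, since otherwise the two
    pieces would overlap.\<close>
  have deg: "Sup K = x" if "(x, K) \<in> p" "(x', K') \<in> p" "(x, K) \<noteq> (x', K')"
      "(Sup K, {x..Sup K}) = (Sup K', {x'..Sup K'})" for x K x' K'
  proof (rule ccontr)
    assume "Sup K \<noteq> x"
    then have "max (Inf K) (Inf K') < min (Sup K) (Sup K')"
      using that tD[OF that(1)] tD[OF that(2)] by (auto simp: Icc_eq_Icc)
    then show False
      using tagged_division_overlap_unique[OF p(1)] that by blast
  qed
  have deg': "Inf K = x" if "(x, K) \<in> p" "(x', K') \<in> p" "(x, K) \<noteq> (x', K')"
      "(Inf K, {Inf K..x}) = (Inf K', {Inf K'..x'})" for x K x' K'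
  proof (rule ccontr)
    assume "Inf K \<noteq> x"
    then have "max (Inf K) (Inf K') < min (Sup K) (Sup K')"
      using that tD[OF that(1)] tD[OF that(2)] by (auto simp: Icc_eq_Icc)
    then show False
      using tagged_division_overlap_unique[OF p(1)] that by blast
  qed
  have "RS_sum g of_real p' = sum ?h (?R ` p) + sum ?h (?L ` p)"
    unfolding RS_sum_def p'_def
  proof (rule sum.union_inter_neutral)
    \<comment> \<open>A right half that is also a left half is a single point, so counting it in
      both sums adds nothing.\<close>
    show "\<forall>y\<in>?R ` p \<inter> ?L ` p. ?h y = 0"
    proof
      fix y assume "y \<in> ?R ` p \<inter> ?L ` p"
      then obtain x K x' K' where *: "(x, K) \<in> p" "(x', K') \<in> p" "y = (Sup K, {x..Sup K})"
          "(Sup K, {x..Sup K}) = (Inf K', {Inf K'..x'})"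
        by auto
      then have "x = Sup K" using tD[OF *(1)] tD[OF *(2)] by (auto simp: Icc_eq_Icc)
      then show "?h y = 0" using * by simp
    qed
  qed (use fin in auto)
  also have "sum ?h (?R ` p) = (\<Sum>(x, K)\<in>p. g (Sup K) * of_real (Sup K - x))"
  proof (subst sum.reindex_nontrivial[OF fin])
    fix y z assume yz: "y \<in> p" "z \<in> p" "y \<noteq> z" "?R y = ?R z"
    obtain x K x' K' where eqs: "y = (x, K)" "z = (x', K')" by (cases y, cases z)
    have "Sup K = x"
      using deg[of x K x' K'] yz eqs by (simp only: prod.case) blast
    then show "?h (?R y) = 0"
      by (simp add: eqs)
  next
    show "sum (?h \<circ> ?R) p = (\<Sum>(x, K)\<in>p. g (Sup K) * of_real (Sup K - x))"
    proof (rule sum.cong[OF refl], clarify)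
      fix x K assume "(x, K) \<in> p"
      then show "(?h \<circ> ?R) (x, K) = g (Sup K) * of_real (Sup K - x)"
        using tD(1,2)[of x K] by simp
    qed
  qed
  also have "sum ?h (?L ` p) = (\<Sum>(x, K)\<in>p. g (Inf K) * of_real (x - Inf K))"
  proof (subst sum.reindex_nontrivial[OF fin])
    fix y z assume yz: "y \<in> p" "z \<in> p" "y \<noteq> z" "?L y = ?L z"
    obtain x K x' K' where eqs: "y = (x, K)" "z = (x', K')" by (cases y, cases z)
    have "Inf K = x"
      using deg'[of x K x' K'] yz eqs by (simp only: prod.case) blast
    then show "?h (?L y) = 0"
      by (simp add: eqs)
  next
    show "sum (?h \<circ> ?L) p = (\<Sum>(x, K)\<in>p. g (Inf K) * of_real (x - Inf K))"
    proof (rule sum.cong[OF refl], clarify)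
      fix x K assume "(x, K) \<in> p"
      then show "(?h \<circ> ?L) (x, K) = g (Inf K) * of_real (x - Inf K)"
        using tD(1,2)[of x K] by simp
    qed
  qed
  finally show "RS_sum g of_real p' =
      (\<Sum>(x, K)\<in>p. g (Sup K) * of_real (Sup K - x) + g (Inf K) * of_real (x - Inf K))"
    by (simp add: sum.distrib case_prod_unfold)
qed

lemma has_RS_integral_identity:
  assumes "a \<le> b" and g: "has_RS_integral g of_real a b I"
  shows "has_RS_integral of_real g a b (of_real b * g b - of_real a * g a - I)"
  unfolding has_RS_integral_def
proof (intro allI impI)
  fix e :: real assume "e > 0"
  then obtain d where d: "d > 0" "\<And>p. p tagged_division_of {a..b} \<Longrightarrow> (\<lambda>x. ball x d) fine p \<Longrightarrow>
      norm (RS_sum g of_real p - I) < e"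
    using g unfolding has_RS_integral_def RS_sum_def by meson
  have "norm ((\<Sum>(x, K)\<in>p. of_real x * (g (Sup K) - g (Inf K)))
      - (of_real b * g b - of_real a * g a - I)) < e"
    if p: "p tagged_division_of {a..b}" "(\<lambda>x. ball x d) fine p" for p
  proof -
    note swap = tagged_division_swap[OF p]
    \<comment> \<open>On a piece \<open>[s, t]\<close>, \<open>x (g t - g s) = (t g t - s g s) - (g
      t (t - x) + g s (x - s))\<close>. The first part telescopes; the second is the Riemann sum
      over the swapped division, which has the same fineness.\<close>
    have "(\<Sum>(x, K)\<in>p. of_real x * (g (Sup K) - g (Inf K))) =
        (\<Sum>(x, K)\<in>p. of_real (Sup K) * g (Sup K) - of_real (Inf K) * g (Inf K))
        - (\<Sum>(x, K)\<in>p. g (Sup K) * of_real (Sup K - x) + g (Inf K) * of_real (x - Inf K))"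
      unfolding sum_subtractf[symmetric] by (intro sum.cong) (auto simp: algebra_simps)
    also have "(\<Sum>(x, K)\<in>p. of_real (Sup K) * g (Sup K) - of_real (Inf K) * g (Inf K))
        = of_real b * g b - of_real a * g a"
      using sum_increments_tagged_division[OF assms(1) p(1), of "\<lambda>u. of_real u * g u"] .
    finally have "(\<Sum>(x, K)\<in>p. of_real x * (g (Sup K) - g (Inf K)))
        - (of_real b * g b - of_real a * g a - I) = I - RS_sum g of_real
          ((\<lambda>(x, K). (Sup K, {x..Sup K})) ` p \<union> (\<lambda>(x, K). (Inf K, {Inf K..x})) ` p)"
      unfolding swap(3) by simp
    then show ?thesis
      using d(2)[OF swap(1,2)] by (simp only: norm_minus_commute)
  qed
  then show "\<exists>d>0. \<forall>p. p tagged_division_of {a..b} \<and> (\<lambda>x. ball x d) fine p \<longrightarrow>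
      norm ((\<Sum>(x, K)\<in>p. of_real x * (g (Sup K) - g (Inf K)))
        - (of_real b * g b - of_real a * g a - I)) < e"
    using d(1) by blast
qed

section \<open>The sawtooth and its Fourier series\<close>

text \<open>The value 0 at integers is the mean of the one-sided limits, which is where the Fourier
  series converges.\<close>

definition sawtooth :: "real \<Rightarrow> real" where
  "sawtooth x = (if x \<in> \<int> then 0 else frac x - 1 / 2)"

text \<open>Multiplied by \<open>sin (pi * t)\<close>, the n-th cosine term becomes the difference
  of \<open>sin ((2n+1) pi t)\<close> and \<open>sin ((2n-1) pi t)\<close>, so the sum
  telescopes.\<close>

lemma Dirichlet_kernel:
  "sin (pi * t) * (\<Sum>n=1..N. 2 * cos (2 * pi * real n * t)) = sin (real (2 * N + 1) * pi * t) - sin (pi * t)"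
proof (induction N)
  case (Suc N)
  have "sin (pi * t) * (2 * cos (2 * pi * real (Suc N) * t)) =
      sin (2 * pi * real (Suc N) * t + pi * t) - sin (2 * pi * real (Suc N) * t - pi * t)"
    by (simp only: sin_add sin_diff) (simp add: algebra_simps)
  also have "\<dots> = sin (real (2 * Suc N + 1) * pi * t) - sin (real (2 * N + 1) * pi * t)"
    by (simp add: algebra_simps)
  finally show ?case using Suc by (simp add: distrib_left)
qed simp

text \<open>
  By the Dirichlet kernel identity, the oscillating main part of the derivative of the partial
  sum is cancelled by that of \<open>cos ((2N+1)\<pi>t) / ((2N+1)\<pi> sin \<pi>t)\<close>, leaving a derivative
  of size \<open>O(1/N)\<close> away from the integers.
\<close>

lemma sin_series_tendsto:
  assumes x: "0 < x" "x < 1"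
  shows "(\<lambda>N. \<Sum>n=1..N. sin (2 * pi * real n * x) / (pi * real n)) \<longlonglongrightarrow> 1 / 2 - x"
proof -
  \<comment> \<open>The segment stays inside (0,1), so by compactness \<open>sin (pi * t)\<close>
    has a positive minimum \<open>m\<close> on it.\<close>
  define S where "S = closed_segment x (1 / 2)"
  have S: "0 < t" "t < 1" if "t \<in> S" for t
    using that x by (auto simp: S_def closed_segment_eq_real_ivl split: if_splits)
  have spos: "sin (pi * t) > 0" if "t \<in> S" for t
    using S[OF that] by (intro sin_gt_zero) auto
  have "compact S" "S \<noteq> {}" by (auto simp: S_def)
  moreover have "continuous_on S (\<lambda>t. sin (pi * t))" by (intro continuous_intros)
  ultimately obtain t0 where "t0 \<in> S" and t0: "\<And>t. t \<in> S \<Longrightarrow> sin (pi * t0) \<le> sin (pi * t)"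
    using continuous_attains_inf by metis
  define m where "m = sin (pi * t0)"
  have m: "m > 0" "\<And>t. t \<in> S \<Longrightarrow> m \<le> sin (pi * t)"
    using spos[OF \<open>t0 \<in> S\<close>] t0 by (auto simp: m_def)
  define h where "h = (\<lambda>N t. cos (real (2 * N + 1) * pi * t) / (real (2 * N + 1) * pi * sin (pi * t)))"
  \<comment> \<open>\<open>G N\<close> is the error of the partial sum against
    \<open>1 / 2 - t\<close>, plus the correction \<open>h N\<close>; \<open>G' N\<close> is what
    survives of its derivative.\<close>
  define G where "G = (\<lambda>N t. (\<Sum>n=1..N. sin (2 * pi * real n * t) / (pi * real n)) + t - 1 / 2 + h N t)"
  define G' where "G' = (\<lambda>N t. - cos (real (2 * N + 1) * pi * t) * cos (pi * t) / (real (2 * N + 1) * (sin (pi * t))\<^sup>2))"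
  have deriv: "(G N has_field_derivative G' N t) (at t within S)" if t: "t \<in> S" for N t
  proof -
    have s0: "sin (pi * t) \<noteq> 0" using spos[OF t] by simp
    define k where "k = real (2 * N + 1)"
    have k0: "k \<noteq> 0" by (simp add: k_def)
    have "((\<lambda>t. sin (2 * pi * real n * t) / (pi * real n)) has_field_derivative
        2 * cos (2 * pi * real n * t)) (at t within S)" if "n \<in> {1..N}" for n
      using that by (auto intro!: derivative_eq_intros)
    then have "((\<lambda>t. \<Sum>n=1..N. sin (2 * pi * real n * t) / (pi * real n)) has_field_derivative
        (\<Sum>n=1..N. 2 * cos (2 * pi * real n * t))) (at t within S)"
      by (rule DERIV_sum)
    moreover have "(\<Sum>n=1..N. 2 * cos (2 * pi * real n * t)) = (sin (k * pi * t) - sin (pi * t)) / sin (pi * t)"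
      unfolding k_def Dirichlet_kernel[of t N, symmetric] using s0 by simp
    then have "(\<Sum>n=1..N. 2 * cos (2 * pi * real n * t)) = sin (k * pi * t) / sin (pi * t) - 1"
      using s0 by (simp add: diff_divide_distrib)
    moreover have "(h N has_field_derivative
        (- sin (k * pi * t) / sin (pi * t) + G' N t)) (at t within S)"
    proof -
      have "((\<lambda>t. cos (k * pi * t) / (k * pi * sin (pi * t))) has_field_derivative
        (- (sin (k * pi * t) * (k * pi)) * (k * pi * sin (pi * t)) -
          cos (k * pi * t) * (k * pi * (cos (pi * t) * pi))) / ((k * pi * sin (pi * t)) * (k * pi * sin (pi * t)))) (at t within S)"
        using s0 k0 by (auto intro!: derivative_eq_intros)
      also have "(- (sin (k * pi * t) * (k * pi)) * (k * pi * sin (pi * t)) -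
          cos (k * pi * t) * (k * pi * (cos (pi * t) * pi))) / ((k * pi * sin (pi * t)) * (k * pi * sin (pi * t)))
        = - sin (k * pi * t) / sin (pi * t) + - cos (k * pi * t) * cos (pi * t) / (k * (sin (pi * t))\<^sup>2)"
      proof -
        \<comment> \<open>With the trigonometric values replaced by free reals, the simplification
          of the quotient rule is pure field arithmetic.\<close>
        have "(- (A * (k * pi)) * (k * pi * B) - C * (k * pi * (D * pi))) / ((k * pi * B) * (k * pi * B))
            = - A / B + - C * D / (k * B\<^sup>2)" if "B \<noteq> 0" for A B C D :: real
          using that k0 by (simp add: divide_simps power2_eq_square) (simp add: algebra_simps)
        from this[OF s0] show ?thesis .
      qed
      finally show ?thesis
        unfolding h_def G'_def k_def .
    qed
    ultimately have "(G N has_field_derivative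
        (sin (k * pi * t) / sin (pi * t) - 1 + 1 - 0 + (- sin (k * pi * t) / sin (pi * t) + G' N t))) (at t within S)"
      unfolding G_def by (intro derivative_intros) auto
    then show ?thesis by simp
  qed
  have bound: "norm (G' N t) \<le> 1 / (m\<^sup>2 * real (2 * N + 1))" if t: "t \<in> S" for N t
  proof -
    have "norm (G' N t) = \<bar>cos (real (2 * N + 1) * pi * t)\<bar> * \<bar>cos (pi * t)\<bar> / (real (2 * N + 1) * (sin (pi * t))\<^sup>2)"
      by (simp add: G'_def abs_mult)
    also have "\<dots> \<le> 1 / (real (2 * N + 1) * (sin (pi * t))\<^sup>2)"
      by (intro divide_right_mono mult_le_one) auto
    also have "\<dots> \<le> 1 / (real (2 * N + 1) * m\<^sup>2)"
      using m t spos[OF t] by (intro divide_left_mono mult_left_mono power_mono) (auto intro!: mult_pos_pos)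
    finally show ?thesis by (simp add: mult.commute)
  qed
  \<comment> \<open>At 1/2 all sines of the sum and the cosine in \<open>h\<close> vanish. Starting
    from this zero, the bound on \<open>G'\<close> along \<open>S\<close> yields
    \<open>G N x = O(1/N)\<close>.\<close>
  have G_half: "G N (1 / 2) = 0" for N
  proof -
    have "sin (2 * pi * real n * (1 / 2)) = 0" for n by (simp add: sin_integer_2pi)
    moreover have "cos (real (2 * N + 1) * pi * (1 / 2)) = 0"
      using cos_zero_iff[of "real (2 * N + 1) * pi * (1 / 2)"] by (auto intro!: exI[of _ "2 * N + 1"])
    ultimately show ?thesis by (simp add: G_def h_def)
  qed
  have "norm (G N x) \<le> 1 / (m\<^sup>2 * real (2 * N + 1)) * norm (x - 1 / 2)" for N
    using field_differentiable_bound[of S "G N" "G' N" "1 / (m\<^sup>2 * real (2 * N + 1))" x "1 / 2"]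
      deriv bound G_half[of N] by (auto simp: S_def)
  moreover have inv0: "(\<lambda>N. 1 / (c * real (2 * N + 1))) \<longlonglongrightarrow> 0" if "c > 0" for c :: real
    using that by real_asymp
  have "(\<lambda>N. 1 / (m\<^sup>2 * real (2 * N + 1)) * norm (x - 1 / 2)) \<longlonglongrightarrow> 0"
    using m(1) by (intro tendsto_mult_left_zero inv0) auto
  ultimately have "(\<lambda>N. G N x) \<longlonglongrightarrow> 0"
    by (intro Lim_null_comparison[of "\<lambda>N. G N x"] always_eventually allI)
  moreover have "(\<lambda>N. h N x) \<longlonglongrightarrow> 0"
  proof (rule Lim_null_comparison)
    have "x \<in> S" by (simp add: S_def)
    have "norm (h N x) = \<bar>cos (real (2 * N + 1) * pi * x)\<bar> / (pi * sin (pi * x) * real (2 * N + 1))" for N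
      using spos[OF \<open>x \<in> S\<close>] by (simp add: h_def abs_mult mult_ac)
    also have "\<dots> N \<le> 1 / (pi * sin (pi * x) * real (2 * N + 1))" for N
      using spos[OF \<open>x \<in> S\<close>] by (intro divide_right_mono) auto
    finally show "\<forall>\<^sub>F N in sequentially. norm (h N x) \<le> 1 / (pi * sin (pi * x) * real (2 * N + 1))"
      by simp
    show "(\<lambda>N. 1 / (pi * sin (pi * x) * real (2 * N + 1))) \<longlonglongrightarrow> 0"
      using spos[OF \<open>x \<in> S\<close>] by (intro inv0) auto
  qed
  ultimately have "(\<lambda>N. G N x - h N x + (1 / 2 - x)) \<longlonglongrightarrow> 0 - 0 + (1 / 2 - x)"
    by (intro tendsto_intros)
  then show ?thesis
    by (simp add: G_def)
qed

text \<open>Every term has period 1, which reduces \<open>x\<close> to \<open>frac x\<close>; at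
  integers all terms vanish.\<close>

lemma sawtooth_sin_series:
  "(\<lambda>N. \<Sum>n=1..N. sin (2 * pi * real n * x) / (pi * real n)) \<longlonglongrightarrow> - sawtooth x"
proof -
  have eq: "sin (2 * pi * real n * x) = sin (2 * pi * real n * frac x)" for n
  proof -
    have "2 * pi * real n * x = 2 * pi * real n * frac x + 2 * pi * real_of_int (int n * \<lfloor>x\<rfloor>)"
      by (simp add: frac_def algebra_simps)
    then show ?thesis
      by (simp only: sin_add sin_int_2pin cos_int_2pin)
  qed
  show ?thesis
  proof (cases "x \<in> \<int>")
    case True
    then show ?thesis unfolding eq by (simp add: sawtooth_def frac_eq_0_iff[THEN iffD2])
  next
    case False
    then have "0 < frac x" "frac x < 1" by (simp_all add: frac_gt_0_iff frac_lt_1)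
    from sin_series_tendsto[OF this] False show ?thesis
      unfolding eq by (simp add: sawtooth_def)
  qed
qed

section \<open>Exponentials, their orthogonality, and psi as an average of sawtooths\<close>

definition efun :: "real \<Rightarrow> complex" where
  "efun x = cis (2 * pi * x)"

lemma efun_add: "efun (x + y) = efun x * efun y"
  by (simp add: efun_def cis_mult distrib_left)

lemma efun_eq_exp: "efun x = exp (2 * pi * \<i> * x)"
  by (simp add: efun_def cis_conv_exp mult_ac)

lemma efun_Ints: "x \<in> \<int> \<Longrightarrow> efun x = 1"
  by (simp add: efun_def)

lemma norm_efun [simp]: "norm (efun x) = 1"
  by (simp add: efun_def)

text \<open>Symmetric partial sums pair \<open>n\<close> with \<open>-n\<close>, and
  \<open>e(y) - e(-y) = 2 i sin(2 pi y)\<close> turns each pair into a term of the sine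
  series.\<close>

lemma sawtooth_exp_series:
  "(\<lambda>N. \<Sum>n\<in>{- int N..int N} - {0}. efun (of_int n * x) / (2 * pi * \<i> * of_int n))
     \<longlonglongrightarrow> - of_real (sawtooth x)"
proof -
  have "(\<Sum>n\<in>{- int N..int N} - {0}. efun (of_int n * x) / (2 * pi * \<i> * of_int n)) =
      of_real (\<Sum>n=1..N. sin (2 * pi * real n * x) / (pi * real n))" for N
  proof (induction N)
    case (Suc N)
    have eq: "{- int (Suc N)..int (Suc N)} - {0} =
        insert (int (Suc N)) (insert (- int (Suc N)) ({- int N..int N} - {0}))"
      by auto
    have "efun (real (Suc N) * x) / (2 * pi * \<i> * of_nat (Suc N)) - efun (- (real (Suc N) * x)) / (2 * pi * \<i> * of_nat (Suc N))
       = of_real (sin (2 * pi * real (Suc N) * x) / (pi * real (Suc N)))"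
    proof -
      have "efun y - efun (- y) = 2 * \<i> * of_real (sin (2 * pi * y))" for y
        by (simp add: efun_def complex_eq_iff)
      then show ?thesis
        unfolding diff_divide_distrib[symmetric] by (simp add: mult.assoc del: of_nat_Suc)
    qed
    then show ?case
      unfolding eq using Suc by (simp add: algebra_simps del: of_nat_Suc)
  qed simp
  then show ?thesis
    using tendsto_of_real[OF sawtooth_sin_series[of x], where 'a = complex] by simp
qed

text \<open>A geometric sum with ratio \<open>w = e(k/q)\<close>: always \<open>w ^ q = 1\<close>,
  while \<open>w = 1\<close> only if \<open>q\<close> divides \<open>k\<close>.\<close>

lemma sum_efun_orthogonal:
  fixes k :: int
  assumes "q \<ge> 1"
  shows "(\<Sum>l=1..q. efun (of_int k * real l / real q)) = (if int q dvd k then of_nat q else 0)"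
proof (cases "int q dvd k")
  case True
  then obtain j where "k = int q * j" by (elim dvdE)
  then have "of_int k * real l / real q = of_int (j * int l)" for l
    using assms by simp
  then have "efun (of_int k * real l / real q) = 1" for l
    using efun_Ints Ints_of_int by metis
  then show ?thesis using True by simp
next
  case False
  define w where "w = efun (of_int k / real q)"
  have pow: "efun (of_int k * real l / real q) = w ^ l" for l
    unfolding w_def efun_def Complex.DeMoivre by (rule arg_cong[of _ _ cis]) simp
  have "w \<noteq> 1"
  proof
    assume "w = 1"
    then obtain j :: int where "2 * pi * (of_int k / real q) = of_int (2 * j) * pi"
      unfolding w_def efun_eq_exp exp_eq_1 by auto
    then have "of_int k = real_of_int (j * int q)"
      using assms by (simp add: field_simps)
    then have "k = j * int q" by (simp only: of_int_eq_iff)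
    then show False using False by simp
  qed
  moreover have "w ^ q = 1"
    using pow[of q] assms efun_Ints[of "of_int k"] by simp
  moreover have "(\<Sum>l=1..q. w ^ l) = w * (\<Sum>l<q. w ^ l)"
    unfolding sum_distrib_left by (rule sum.reindex_bij_witness[of _ Suc "\<lambda>l. l - 1"]) (auto simp: power_Suc[symmetric])
  ultimately show ?thesis
    using False by (simp add: pow geometric_sum)
qed

text \<open>
  The congruence condition is detected by characters. The partial sums defining \<open>psi\<close> run over
  \<open>- M q + r \<le> n \<le> M q + r\<close>; the boundedly many terms that complete them to \<open>\<bar>n\<bar> \<le> M q + r\<close>
  are each \<open>O(1/M)\<close>.
\<close>

lemma psi_eq_sum_sawtooth:
  assumes r: "r \<in> {1..q}"
  shows "psi u r q = (\<Sum>l=1..q. efun (real l * real r / real q) / of_nat q * of_real (sawtooth (u - real l / real q)))"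
    (is "_ = ?R")
proof -
  define t :: "int \<Rightarrow> complex" where "t = (\<lambda>n. efun (of_int n * u) / (2 * pi * \<i> * of_int n))"
  \<comment> \<open>\<open>V N\<close> collects the indices congruent to \<open>r\<close> in a
    symmetric window, as the Fourier series produces them; \<open>A M\<close> is the index set in
    the definition of \<open>psi\<close>.\<close>
  define V where "V = (\<lambda>N. {n \<in> {- int N..int N} - {0}. int q dvd int r - n})"
  define A where "A = (\<lambda>M. {n. \<exists>m\<in>{- int M..int M}. n = m * int q + int r} - {0})"
  have q: "q \<ge> 1" using r by simp
  have "(\<Sum>l=1..q. efun (real l * real r / real q) / of_nat q *
      (\<Sum>n\<in>{- int N..int N} - {0}. efun (of_int n * (u - real l / real q)) / (2 * pi * \<i> * of_int n)))
    = sum t (V N)" for N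
  proof -
    \<comment> \<open>Translating by \<open>l / q\<close> multiplies the n-th term by
      \<open>e(-n l / q)\<close>, so after interchanging the sums the inner one is the orthogonality
      sum for \<open>r - n\<close>.\<close>
    have char_eq: "efun (real l * real r / real q) * efun (of_int n * (u - real l / real q))
        = efun (of_int n * u) * efun (of_int (int r - n) * real l / real q)" for n l
      unfolding efun_add[symmetric] by (rule arg_cong[of _ _ efun]) (use q in \<open>simp add: field_simps\<close>)
    have "(\<Sum>l=1..q. efun (real l * real r / real q) / of_nat q *
        (\<Sum>n\<in>{- int N..int N} - {0}. efun (of_int n * (u - real l / real q)) / (2 * pi * \<i> * of_int n)))
      = (\<Sum>l=1..q. \<Sum>n\<in>{- int N..int N} - {0}. t n / of_nat q * efun (of_int (int r - n) * real l / real q))"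
      unfolding sum_distrib_left
    proof (intro sum.cong refl)
      fix l n
      have "efun (real l * real r / real q) / of_nat q * (efun (of_int n * (u - real l / real q)) / (2 * pi * \<i> * of_int n))
        = (efun (real l * real r / real q) * efun (of_int n * (u - real l / real q))) / of_nat q / (2 * pi * \<i> * of_int n)"
        by simp
      then show "efun (real l * real r / real q) / of_nat q * (efun (of_int n * (u - real l / real q)) / (2 * pi * \<i> * of_int n))
        = t n / of_nat q * efun (of_int (int r - n) * real l / real q)"
        unfolding char_eq t_def by (simp only: times_divide_eq_left times_divide_eq_right divide_divide_eq_left mult.commute)
    qed
    also have "\<dots> = (\<Sum>n\<in>{- int N..int N} - {0}. t n / of_nat q * (\<Sum>l=1..q. efun (of_int (int r - n) * real l / real q)))"
      by (subst sum.swap) (simp add: sum_distrib_left)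
    also have "\<dots> = (\<Sum>n\<in>{- int N..int N} - {0}. if int q dvd int r - n then t n else 0)"
      unfolding sum_efun_orthogonal[OF q] using q by (intro sum.cong refl) simp
    also have "\<dots> = sum t (V N)"
      unfolding V_def by (rule sum.inter_filter[symmetric]) simp
    finally show ?thesis .
  qed
  moreover have "(\<lambda>N. \<Sum>l=1..q. efun (real l * real r / real q) / of_nat q *
      (\<Sum>n\<in>{- int N..int N} - {0}. efun (of_int n * (u - real l / real q)) / (2 * pi * \<i> * of_int n)))
    \<longlonglongrightarrow> (\<Sum>l=1..q. efun (real l * real r / real q) / of_nat q * - of_real (sawtooth (u - real l / real q)))"
    by (intro tendsto_sum tendsto_mult_left sawtooth_exp_series)
  ultimately have "(\<lambda>N. sum t (V N)) \<longlonglongrightarrow> - ?R"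
    by (simp add: sum_negf)
  \<comment> \<open>The window \<open>M * q + r\<close> ends exactly at the largest element of
    \<open>A M\<close>, so it has excess terms only at its negative end.\<close>
  moreover have "filterlim (\<lambda>M. M * q + r) sequentially sequentially"
    using q by (auto intro!: filterlim_subseq strict_monoI)
  ultimately have lim1: "(\<lambda>M. sum t (V (M * q + r))) \<longlonglongrightarrow> - ?R"
    by (rule filterlim_compose)
  have "(\<lambda>M. sum t (V (M * q + r)) - sum t (A M)) \<longlonglongrightarrow> 0"
  proof (rule Lim_null_comparison)
    show "(\<lambda>M. real (2 * q + 1) * (1 / real (M - 1))) \<longlonglongrightarrow> 0"
      by real_asymp
    show "\<forall>\<^sub>F M in sequentially. norm (sum t (V (M * q + r)) - sum t (A M)) \<le> real (2 * q + 1) * (1 / real (M - 1))"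
      using eventually_ge_at_top[of 2]
    proof eventually_elim
      fix M :: nat assume M: "M \<ge> 2"
      define E where "E = V (M * q + r) - A M"
      have fin: "finite (V (M * q + r))"
        by (rule finite_subset[of _ "{- int (M * q + r)..int (M * q + r)}"]) (auto simp: V_def)
      have "A M \<subseteq> V (M * q + r)"
      proof
        fix n assume "n \<in> A M"
        then obtain m where m: "- int M \<le> m" "m \<le> int M" "n = m * int q + int r" "n \<noteq> 0"
          by (auto simp: A_def)
        have "m * int q \<le> int M * int q" "- int M * int q \<le> m * int q"
          using m by (auto intro!: mult_right_mono simp del: mult_minus_left)
        then show "n \<in> V (M * q + r)"
          using m by (auto simp: V_def)
      qed
      then have diff: "sum t (V (M * q + r)) - sum t (A M) = sum t E"
        unfolding E_def using sum_diff[OF fin, of "A M" t] by simp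
      \<comment> \<open>An excess index \<open>n = m q + r\<close> has \<open>m \<le> M\<close> by
        the window, hence \<open>m < - M\<close>. The resulting range contains
        \<open>2 r + 1 \<le> 2 q + 1\<close> integers.\<close>
      have E: "E \<subseteq> {- int (M * q + r)..- int (M * q) + int r}"
      proof
        fix n assume n: "n \<in> E"
        then obtain j where j: "int r - n = int q * j" by (auto simp: E_def V_def elim: dvdE)
        define m where "m = - j"
        have nm: "n = m * int q + int r" using j by (simp add: m_def mult.commute)
        have bounds: "- int (M * q + r) \<le> n" "n \<le> int (M * q + r)" "n \<noteq> 0"
          using n by (auto simp: E_def V_def)
        have "m * int q \<le> int M * int q" using bounds(2) nm by simp
        then have "m \<le> int M" using q by simp
        moreover have "m \<notin> {- int M..int M}"
          using n nm bounds(3) by (auto simp: E_def A_def)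
        ultimately have "m \<le> - int M" by simp
        then have "m * int q \<le> - int M * int q" by (intro mult_right_mono) auto
        then show "n \<in> {- int (M * q + r)..- int (M * q) + int r}"
          using bounds(1) nm by simp
      qed
      have "card E \<le> card {- int (M * q + r)..- int (M * q) + int r}"
        using E by (intro card_mono) auto
      also have "\<dots> \<le> 2 * q + 1" using r by (simp add: nat_le_iff)
      finally have card: "card E \<le> 2 * q + 1" .
      have "norm (t n) \<le> 1 / real (M - 1)" if n: "n \<in> E" for n
      proof -
        \<comment> \<open>Here
          \<open>\<bar>n\<bar> \<ge> M q - r \<ge> (M - 1) q \<ge> M - 1\<close>, using
          \<open>r \<le> q\<close>.\<close>
        have "int (M - 1) * 1 \<le> (int M - 1) * int q" using M q by (intro mult_mono) auto
        also have "\<dots> = int (M * q) - int q" by (simp add: algebra_simps)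
        also have "\<dots> \<le> int (M * q) - int r" using r by simp
        also have "\<dots> \<le> \<bar>n\<bar>" using subsetD[OF E n] unfolding atLeastAtMost_iff by linarith
        finally have "real (M - 1) \<le> \<bar>of_int n\<bar>" by linarith
        also have "\<dots> \<le> 2 * pi * \<bar>of_int n\<bar>"
          using pi_gt3 mult_right_mono[of 1 "2 * pi" "\<bar>of_int n\<bar>"] by simp
        finally have "1 / (2 * pi * \<bar>of_int n\<bar>) \<le> 1 / real (M - 1)"
          using M by (intro divide_left_mono mult_pos_pos) auto
        then show ?thesis by (simp add: t_def norm_divide norm_mult)
      qed
      then have "norm (sum t E) \<le> of_nat (card E) * (1 / real (M - 1))"
        by (intro sum_norm_bound)
      also have "\<dots> \<le> real (2 * q + 1) * (1 / real (M - 1))"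
        using card by (intro mult_right_mono) (auto simp only: of_nat_le_iff zero_le_divide_1_iff of_nat_0_le_iff)
      finally show "norm (sum t (V (M * q + r)) - sum t (A M)) \<le> real (2 * q + 1) * (1 / real (M - 1))"
        unfolding diff .
    qed
  qed
  from tendsto_diff[OF lim1 this] have "(\<lambda>M. sum t (A M)) \<longlonglongrightarrow> - ?R"
    by simp
  moreover have "psi u r q = - lim (\<lambda>M. sum t (A M))"
    unfolding psi_def t_def A_def efun_eq_exp by (simp add: mult.assoc)
  ultimately show ?thesis
    by (simp add: limI)
qed

section \<open>Integrating a shifted sawtooth\<close>

lemma sawtooth_of_neg: "-1 < x \<Longrightarrow> x < 0 \<Longrightarrow> sawtooth x = x + 1 / 2"
proof -
  assume x: "-1 < x" "x < 0"
  then have "frac x = x + 1" by (subst frac_unique_iff) auto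
  moreover from this have "x \<notin> \<int>" using x by (simp add: frac_eq_0_iff[symmetric])
  ultimately show ?thesis by (simp add: sawtooth_def)
qed

lemma sawtooth_of_pos: "0 < x \<Longrightarrow> x < 1 \<Longrightarrow> sawtooth x = x - 1 / 2"
proof -
  assume x: "0 < x" "x < 1"
  then have "frac x = x" by (subst frac_unique_iff) auto
  moreover from this have "x \<notin> \<int>" using x by (simp add: frac_eq_0_iff[symmetric])
  ultimately show ?thesis by (simp add: sawtooth_def)
qed

text \<open>The sawtooth is the identity plus a constant plus steps. Constants integrate to 0
  because \<open>F 0 = F 1\<close>, the identity gives \<open>F 1 - J\<close> by parts, and the jump
  at an interior \<open>c\<close> gives \<open>F c - F 0\<close>.\<close>

lemma has_RS_integral_sawtooth:
  assumes F: "has_RS_integral F of_real 0 1 J" "F 0 = F 1"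
    and c: "0 < c" "c \<le> 1" and cont: "isCont F c" "c = 1 \<Longrightarrow> isCont F 0"
  shows "has_RS_integral (\<lambda>u. of_real (sawtooth (u - c))) F 0 1 (F c - J)"
proof -
  have id: "has_RS_integral of_real F 0 1 (F 1 - J)"
    using has_RS_integral_identity[OF _ F(1)] by simp
  have const: "has_RS_integral (\<lambda>u. k) F 0 1 0" for k
    using has_RS_integral_const[of 0 1 k F] F(2) by simp
  have lt: "has_RS_integral (\<lambda>u. if u < c then 1 else 0) F 0 1 (F c - F 0)"
    using c cont(1) by (intro has_RS_integral_step) auto
  show ?thesis
  proof (cases "c = 1")
    case False
    have le: "has_RS_integral (\<lambda>u. if u \<le> c then 1 else 0) F 0 1 (F c - F 0)"
      using c cont(1) by (intro has_RS_integral_step) auto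
    \<comment> \<open>Averaging the indicators of \<open>u < c\<close> and \<open>u \<le> c\<close>
      gives 1/2 at \<open>c\<close>, matching the sawtooth value 0 there.\<close>
    have "has_RS_integral (\<lambda>u. of_real u + (- of_real (c + 1 / 2) +
        1 / 2 * ((if u < c then 1 else 0) + (if u \<le> c then 1 else 0)))) F 0 1
        (F 1 - J + (0 + 1 / 2 * ((F c - F 0) + (F c - F 0))))"
      by (intro has_RS_integral_add has_RS_integral_cmult id const lt le)
    then have "has_RS_integral (\<lambda>u. of_real (sawtooth (u - c))) F 0 1
        (F 1 - J + (0 + 1 / 2 * ((F c - F 0) + (F c - F 0))))"
    proof (rule has_RS_integral_cong)
      fix u :: real assume u: "u \<in> {0..1}"
      consider "u < c" | "u = c" | "u > c" by linarith
      then show "of_real u + (- of_real (c + 1 / 2) +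
          1 / 2 * ((if u < c then 1 else 0) + (if u \<le> c then 1 else 0))) = complex_of_real (sawtooth (u - c))"
        using u c False
        by cases (auto simp: sawtooth_of_neg sawtooth_of_pos, auto simp: sawtooth_def)
    qed simp
    moreover have "F 1 - J + (0 + 1 / 2 * ((F c - F 0) + (F c - F 0))) = F c - J"
      using F(2) by (simp add: field_simps)
    ultimately show ?thesis by (simp only:)
  next
    case True
    \<comment> \<open>For \<open>c = 1\<close> the jump sits at both ends of the interval: half a
      step after 0 and half a step before 1 produce the value 0 at each end. Continuity at 0 makes
      the first contribute nothing.\<close>
    have le: "has_RS_integral (\<lambda>u. if u \<le> 0 then 1 else 0) F 0 1 (F 0 - F 0)"
      using cont(2) True by (intro has_RS_integral_step) auto
    have "has_RS_integral (\<lambda>u. of_real u + (- 1 +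
        1 / 2 * ((if u < c then 1 else 0) + (if u \<le> 0 then 1 else 0)))) F 0 1
        (F 1 - J + (0 + 1 / 2 * ((F c - F 0) + (F 0 - F 0))))"
      by (intro has_RS_integral_add has_RS_integral_cmult id const lt le)
    then have "has_RS_integral (\<lambda>u. of_real (sawtooth (u - c))) F 0 1
        (F 1 - J + (0 + 1 / 2 * ((F c - F 0) + (F 0 - F 0))))"
    proof (rule has_RS_integral_cong)
      fix u :: real assume u: "u \<in> {0..1}"
      consider "u = 0" | "0 < u" "u < 1" | "u = 1" using u by force
      then show "of_real u + (- 1 +
          1 / 2 * ((if u < c then 1 else 0) + (if u \<le> 0 then 1 else 0))) = complex_of_real (sawtooth (u - c))"
        using True
        by cases (auto simp: sawtooth_of_neg, auto simp: sawtooth_def)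
    qed simp
    then show ?thesis using F(2) True by simp
  qed
qed

section \<open>Discrete Fourier coefficients and inversion\<close>

theorem theorem2:
  fixes q :: nat and f :: "real \<Rightarrow> complex"
  assumes "q \<ge> 1"
    and "Riemann_integrable f 0 1"
    and "f 0 = f 1"
    and "\<And>l. l \<in> {1..q} \<Longrightarrow> isCont (periodize f) (real l / real q)"
  shows "(\<forall>r\<in>{1..q}. RS_integrable (\<lambda>u. psi u r q) f 0 1) \<and>
    (\<forall>a\<in>{1..q}. f (real a / real q) =
       (\<Sum>r = 1..q. fcoeff f q r * exp (2 * pi * \<i> * of_nat r * of_nat a / of_nat q)))"
proof -
  define F where "F = periodize f"
  define J where "J = integral {0..1} f"
  have Ff: "F u = f u" if "u \<in> {0..1}" for u
  proof (cases "u = 1")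
    case False
    then have "frac u = u" using that by (subst frac_unique_iff) auto
    then show ?thesis by (simp add: F_def periodize_def)
  qed (simp add: F_def periodize_def assms(3))
  have "has_RS_integral f of_real 0 1 (RS_integral f of_real 0 1)"
    using assms(2) by (rule RS_integrable_has_integral)
  moreover from this have "RS_integral f of_real 0 1 = J"
    unfolding J_def by (rule integral_unique[OF has_RS_integral_of_real_imp_has_integral, symmetric])
  ultimately have "has_RS_integral f of_real 0 1 J" by simp
  then have FJ: "has_RS_integral F of_real 0 1 J"
    by (rule has_RS_integral_cong) (auto simp: Ff)
  have F01: "F 0 = F 1" by (simp add: Ff assms(3))
  have cont: "isCont F (real l / real q)" if "l \<in> {1..q}" for l
    using assms(4)[OF that] by (simp add: F_def)
  \<comment> \<open>The grid point \<open>q / q = 1\<close> supplies continuity at 1, and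
    periodicity carries it to 0.\<close>
  have "isCont F 1" using cont[of q] assms(1) by simp
  then have "isCont (\<lambda>x. F (x + 1)) 0"
    by (intro isCont_o2[where f = "\<lambda>x. x + 1" and g = F and a = 0]) auto
  moreover have "(\<lambda>x. F (x + 1)) = F" by (simp add: F_def periodize_def[abs_def] frac_1_eq)
  ultimately have cont0: "isCont F 0" by simp

  \<comment> \<open>The discrete Fourier sum of the samples \<open>f(l/q)\<close>. Its argument is
    real so that the negative frequency \<open>- real r\<close> is allowed.\<close>
  define S where "S = (\<lambda>k. \<Sum>l=1..q. efun (real l * k / real q) / of_nat q * F (real l / real q))"
  have RS_psi: "has_RS_integral (\<lambda>u. psi u r q) f 0 1 (S (real r) - (if r = q then J else 0))"
    if r: "r \<in> {1..q}" for r
  proof -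
    have "has_RS_integral (\<lambda>u. psi u r q) F 0 1
        (\<Sum>l=1..q. efun (real l * real r / real q) / of_nat q * (F (real l / real q) - J))"
      unfolding psi_eq_sum_sawtooth[OF r]
      by (intro has_RS_integral_sum has_RS_integral_cmult has_RS_integral_sawtooth FJ F01 cont cont0)
        (use r in auto)
    \<comment> \<open>Each sawtooth contributes \<open>- J\<close>; weighted by the characters these
      cancel unless \<open>r = q\<close>, where they total \<open>- J\<close>. The term
      \<open>integral {0..1} f\<close> in \<open>fcoeff\<close> restores it.\<close>
    moreover have "(\<Sum>l=1..q. efun (real l * real r / real q) / of_nat q * (F (real l / real q) - J))
        = S (real r) - (\<Sum>l=1..q. efun (of_int (int r) * real l / real q)) / of_nat q * J"
      by (simp add: S_def sum_subtractf right_diff_distrib sum_divide_distrib sum_distrib_right mult.commute[of "real r"])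
    moreover have "int q dvd int r \<longleftrightarrow> r = q"
      using r by (auto dest: dvd_imp_le)
    ultimately have "has_RS_integral (\<lambda>u. psi u r q) F 0 1 (S (real r) - (if r = q then J else 0))"
      using assms(1) by (simp only: sum_efun_orthogonal[OF assms(1)]) (auto split: if_splits)
    then show ?thesis
      by (rule has_RS_integral_cong) (auto simp: Ff)
  qed

  have S_period: "S (real q + k) = S k" for k
  proof -
    have "real l * (real q + k) / real q = real l + real l * k / real q" for l
      using assms(1) by (simp add: field_simps)
    then show ?thesis
      by (simp add: S_def efun_add efun_Ints)
  qed
  \<comment> \<open>The index \<open>q - r\<close> in \<open>fcoeff\<close> becomes frequency
    \<open>- r\<close> by periodicity of \<open>S\<close>, as inversion requires.\<close>
  have coeff: "fcoeff f q r = S (- real r)" if r: "r \<in> {1..q}" for r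
  proof (cases "r = q")
    case True
    have "fcoeff f q r = S (real q)"
      using RS_integral_eqI[OF RS_psi[of q]] assms(1) by (simp add: fcoeff_def True J_def)
    also have "\<dots> = S (- real r)"
      using S_period[of 0] S_period[of "- real q"] True by simp
    finally show ?thesis .
  next
    case False
    then have "q - r \<in> {1..q}" "q - r \<noteq> q" using r by auto
    then have "fcoeff f q r = S (real (q - r))"
      using RS_integral_eqI[OF RS_psi[of "q - r"]] False by (simp add: fcoeff_def)
    also have "\<dots> = S (- real r)"
      using S_period[of "- real r"] r by (simp add: of_nat_diff)
    finally show ?thesis .
  qed
  have "(\<Sum>r=1..q. fcoeff f q r * exp (2 * pi * \<i> * of_nat r * of_nat a / of_nat q)) = f (real a / real q)"
    if a: "a \<in> {1..q}" for a
  proof -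
    have "(\<Sum>r=1..q. fcoeff f q r * exp (2 * pi * \<i> * of_nat r * of_nat a / of_nat q))
        = (\<Sum>r=1..q. \<Sum>l=1..q. F (real l / real q) / of_nat q * efun (of_int (int a - int l) * real r / real q))"
    proof (intro sum.cong refl)
      fix r assume r: "r \<in> {1..q}"
      have e: "exp (2 * pi * \<i> * of_nat r * of_nat a / of_nat q) = efun (real r * real a / real q)"
        by (simp add: efun_eq_exp mult.assoc)
      have "efun (real l * - real r / real q) * efun (real r * real a / real q)
          = efun (of_int (int a - int l) * real r / real q)" for l
        unfolding efun_add[symmetric]
        by (rule arg_cong[of _ _ efun]) (simp add: diff_divide_distrib algebra_simps)
      then show "fcoeff f q r * exp (2 * pi * \<i> * of_nat r * of_nat a / of_nat q)
          = (\<Sum>l=1..q. F (real l / real q) / of_nat q * efun (of_int (int a - int l) * real r / real q))"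
        unfolding coeff[OF r] e S_def sum_distrib_right by (intro sum.cong refl) (simp add: mult_ac)
    qed
    also have "\<dots> = (\<Sum>l=1..q. F (real l / real q) / of_nat q * (if int q dvd int a - int l then of_nat q else 0))"
      by (subst sum.swap) (simp only: sum_distrib_left[symmetric] sum_efun_orthogonal[OF assms(1)])
    also have "\<dots> = (\<Sum>l=1..q. if l = a then F (real l / real q) else 0)"
    proof (intro sum.cong refl)
      fix l assume l: "l \<in> {1..q}"
      \<comment> \<open>Both indices lie in \<open>{1..q}\<close>, so their difference is a multiple
        of \<open>q\<close> only when it is 0; just the sample at \<open>a\<close> survives.\<close>
      have "\<bar>int a - int l\<bar> < int q" using a l by auto
      then have "int q dvd int a - int l \<longleftrightarrow> l = a"
        using zdvd_not_zless[of "\<bar>int a - int l\<bar>" "int q"] by auto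
      then show "F (real l / real q) / of_nat q * (if int q dvd int a - int l then of_nat q else 0)
          = (if l = a then F (real l / real q) else 0)"
        using assms(1) by simp
    qed
    also have "\<dots> = f (real a / real q)"
      using a by (simp add: Ff)
    finally show ?thesis .
  qed
  moreover have "\<forall>r\<in>{1..q}. RS_integrable (\<lambda>u. psi u r q) f 0 1"
    using RS_psi unfolding RS_integrable_def by blast
  ultimately show ?thesis
    by (metis (no_types, lifting))
qed

end
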